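(* For every positive integer $d$, $box(TC(H_d)) \leq cub(TC(H_d)) \leq d-1$.
   Context: All graphs are finite, simple and undirected. Boxicity and cubicity: a $k$-box (resp. $k$-cube) is a Cartesian product of $k$ closed intervals (resp. closed unit-length intervals) of $\mathbb{R}$. A $k$-box (resp. $k$-cube) representation of a graph $\Gamma$ is a function $f$ assigning to each vertex a $k$-box (resp. $k$-cube) such that two distinct vertices $u,v$ are adjacent if and only if $f(u)\cap f(v)\neq\emptyset$. The boxicity $box(\Gamma)$ (resp. cubicity $cub(\Gamma)$) is the smallest non-negative integer $k$ for which $\Gamma$ has a $k$-box (resp. $k$-cube) representation; complete graphs have boxicity and cubicity $0$. $TC(H_d)$, the transitive closure of the $d$-dimensional hypercube, is the graph with vertex set $\{0,1\}^d$ in which two distinct vertices $x,y$ are adjacent if and only if either $x_i\leq y_i$ for all $i$, or $x_i\geq y_i$ for all $i$ (equivalently, the comparability graph of the power set of $\{1,\dots,d\}$ ordered by inclusion). *)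

theory Defs
  imports "HOL-Analysis.Analysis" "Graph_Theory.Pair_Digraph"
begin

text \<open>
  A finite simple undirected graph is a \<^term>\<open>G :: 'a pair_pre_digraph\<close> with \<^term>\<open>pair_graph G\<close>:
  the arc set \<^term>\<open>parcs G\<close> is a finite, symmetric and irreflexive relation on \<^term>\<open>pverts G\<close>.
\<close>

text \<open>
  Points of k-dimensional space are the functions extensional on \<^term>\<open>{1..k}\<close>, so that the
  dimension can vary. For \<^term>\<open>k = 0\<close> the only box (and cube) is the one-point space.
\<close>

definition is_box :: "nat \<Rightarrow> (nat \<Rightarrow> real) set \<Rightarrow> bool" where
  "is_box k B \<longleftrightarrow> (\<exists>l u. (\<forall>i\<in>{1..k}. l i \<le> u i) \<and> B = (\<Pi>\<^sub>E i\<in>{1..k}. {l i..u i}))"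

definition is_cube :: "nat \<Rightarrow> (nat \<Rightarrow> real) set \<Rightarrow> bool" where
  "is_cube k B \<longleftrightarrow> (\<exists>l. B = (\<Pi>\<^sub>E i\<in>{1..k}. {l i..l i + 1}))"

definition intersection_rep :: "'a pair_pre_digraph \<Rightarrow> ('a \<Rightarrow> 'b set) \<Rightarrow> bool" where
  "intersection_rep G f \<longleftrightarrow>
     (\<forall>u\<in>pverts G. \<forall>v\<in>pverts G. u \<noteq> v \<longrightarrow> ((u, v) \<in> parcs G \<longleftrightarrow> f u \<inter> f v \<noteq> {}))"

definition box_rep :: "nat \<Rightarrow> 'a pair_pre_digraph \<Rightarrow> ('a \<Rightarrow> (nat \<Rightarrow> real) set) \<Rightarrow> bool" where
  "box_rep k G f \<longleftrightarrow> (\<forall>v\<in>pverts G. is_box k (f v)) \<and> intersection_rep G f"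

definition cube_rep :: "nat \<Rightarrow> 'a pair_pre_digraph \<Rightarrow> ('a \<Rightarrow> (nat \<Rightarrow> real) set) \<Rightarrow> bool" where
  "cube_rep k G f \<longleftrightarrow> (\<forall>v\<in>pverts G. is_cube k (f v)) \<and> intersection_rep G f"

text \<open>
  The minima below range over nonempty sets for every finite simple graph; see
  \<open>ex_cube_rep\<close> and \<open>cube_rep_imp_box_rep\<close>.
\<close>

definition boxicity :: "'a pair_pre_digraph \<Rightarrow> nat" where
  "boxicity G = (LEAST k. \<exists>f. box_rep k G f)"

definition cubicity :: "'a pair_pre_digraph \<Rightarrow> nat" where
  "cubicity G = (LEAST k. \<exists>f. cube_rep k G f)"

definition TC_hypercube :: "nat \<Rightarrow> (nat \<Rightarrow> nat) pair_pre_digraph" where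
  "TC_hypercube d =
     \<lparr> pverts = {1..d} \<rightarrow>\<^sub>E {0, 1},
       parcs = {(x, y). x \<in> {1..d} \<rightarrow>\<^sub>E {0, 1} \<and> y \<in> {1..d} \<rightarrow>\<^sub>E {0, 1} \<and> x \<noteq> y \<and>
                  ((\<forall>i\<in>{1..d}. x i \<le> y i) \<or> (\<forall>i\<in>{1..d}. x i \<ge> y i))} \<rparr>"

lemma pair_graph_TC_hypercube: "pair_graph (TC_hypercube d)"
proof -
  let ?V = "{1..d} \<rightarrow>\<^sub>E {0, 1::nat}"
  have fin: "finite ?V" by (intro finite_PiE) auto
  have "parcs (TC_hypercube d) \<subseteq> ?V \<times> ?V" by (auto simp: TC_hypercube_def)
  then have "finite (parcs (TC_hypercube d))" using fin finite_subset by blast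
  moreover have "sym (parcs (TC_hypercube d))"
    by (rule symI) (auto simp: TC_hypercube_def)
  moreover have "pverts (TC_hypercube d) = ?V" by (simp add: TC_hypercube_def)
  moreover have "e \<in> ?V \<times> ?V \<and> fst e \<noteq> snd e" if "e \<in> parcs (TC_hypercube d)" for e
    using that by (auto simp: TC_hypercube_def)
  ultimately show ?thesis
    using fin by unfold_locales (simp_all add: symmetric_def mem_Times_iff)
qed

lemma cube_rep_imp_box_rep: "cube_rep k G f \<Longrightarrow> box_rep k G f"
proof -
  have "is_box k B" if cube: "is_cube k B" for B
  proof -
    obtain l where "B = (\<Pi>\<^sub>E i\<in>{1..k}. {l i..l i + 1})"
      using cube unfolding is_cube_def by blast
    then show ?thesis
      unfolding is_box_def by (intro exI[of _ l] exI[of _ "\<lambda>i. l i + 1"]) simp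
  qed
  then show "cube_rep k G f \<Longrightarrow> box_rep k G f"
    by (auto simp: cube_rep_def box_rep_def)
qed

lemma ex_cube_rep:
  assumes "pair_graph G"
  shows "\<exists>k f. cube_rep k G f"
proof -
  interpret pair_graph G by fact
  obtain e where e: "bij_betw e {1..card (pverts G)} (pverts G)"
    using ex_bij_betw_nat_finite_1[OF pair_finite_verts] by blast
  define k where "k = card (pverts G)"
  define c where "c v i = (if v = e i then 0 else if (v, e i) \<in> parcs G then 1 else (2::real))" for v i
  define f where "f v = (\<Pi>\<^sub>E i\<in>{1..k}. {c v i..c v i + 1})" for v
  have sym: "(v, u) \<in> parcs G" if "(u, v) \<in> parcs G" for u v
    using pair_sym_arcs that by (auto simp: symmetric_def sym_def)
  have "(u, v) \<in> parcs G \<longleftrightarrow> f u \<inter> f v \<noteq> {}"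
    if uv: "u \<in> pverts G" "v \<in> pverts G" "u \<noteq> v" for u v
  proof
    assume adj: "(u, v) \<in> parcs G"
    have "max (c u i) (c v i) \<in> {c u i..c u i + 1} \<inter> {c v i..c v i + 1}" for i
      using adj sym[OF adj] uv(3) by (auto simp: c_def)
    then have "(\<lambda>i\<in>{1..k}. max (c u i) (c v i)) \<in> f u \<inter> f v"
      by (simp add: f_def restrict_PiE_iff)
    then show "f u \<inter> f v \<noteq> {}" by blast
  next
    assume "f u \<inter> f v \<noteq> {}"
    then obtain p where p: "p \<in> f u" "p \<in> f v" by blast
    obtain i where i: "i \<in> {1..k}" "e i = v"
      using e uv(2) unfolding k_def bij_betw_def by (metis imageE)
    have "p i \<in> {c u i..c u i + 1}" "p i \<in> {c v i..c v i + 1}"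
      using p[unfolded f_def] i(1) by (simp_all only: PiE_iff)
    then show "(u, v) \<in> parcs G"
      using i(2) uv(3) by (auto simp: c_def split: if_splits)
  qed
  then have "intersection_rep G f" by (simp add: intersection_rep_def)
  moreover have "is_cube k (f v)" for v
    unfolding is_cube_def f_def by (rule exI[of _ "c v"]) (rule refl)
  ultimately have "cube_rep k G f" by (simp add: cube_rep_def)
  then show ?thesis by blast
qed

end

theory Submission
  imports Defs
begin

text \<open>
  View vertices as subsets of \<open>{1..d}\<close>. Let \<open>A, B\<close> be incomparable, let \<open>m\<close> be the largest element
  on which they differ, say \<open>m \<in> B\<close>, and let \<open>i \<in> A - B\<close>, so \<open>i < m\<close>. For \<open>i \<le> d - 2\<close>, the \<open>i\<close>-th
  cube coordinate places the sets without \<open>i\<close> one unit to the right of the sets with \<open>i\<close>, plus a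
  perturbation below 1 that orders the sets \<open>S - {i}\<close> by their binary value; it separates
  \<open>A\<close> from \<open>B\<close> since \<open>A - {i}\<close> has a smaller binary value than \<open>B\<close>. It does not separate sets
  \<open>B \<subseteq> A\<close> with \<open>i \<in> A - B\<close>, because then \<open>B \<subseteq> A - {i}\<close>. The remaining case \<open>i = d - 1\<close>, \<open>m = d\<close>
  is settled by the single coordinate \<open>[d \<in> S] - [d - 1 \<in> S]\<close>, which differs by more than 1 only
  if \<open>d\<close> and \<open>d - 1\<close> lie in opposite differences.
\<close>

text \<open>Products intersect coordinatewise, and a product is nonempty exactly when every factor
  is.\<close>

lemma unit_cubes_meet_iff:
  fixes a b :: "nat \<Rightarrow> real"
  shows "(\<Pi>\<^sub>E i\<in>I. {a i..a i + 1}) \<inter> (\<Pi>\<^sub>E i\<in>I. {b i..b i + 1}) \<noteq> {}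
    \<longleftrightarrow> (\<forall>i\<in>I. \<bar>a i - b i\<bar> \<le> 1)"
proof -
  have "{a i..a i + 1} \<inter> {b i..b i + 1} \<noteq> {} \<longleftrightarrow> \<bar>a i - b i\<bar> \<le> 1" for i
    by (auto simp: Int_atLeastAtMost)
  then show ?thesis
    by (simp add: PiE_Int PiE_eq_empty_iff)
qed

lemma cube_rep_of_corners:
  fixes c :: "'a \<Rightarrow> nat \<Rightarrow> real"
  assumes "\<And>u v. \<lbrakk>u \<in> pverts G; v \<in> pverts G; u \<noteq> v\<rbrakk>
    \<Longrightarrow> (u, v) \<in> parcs G \<longleftrightarrow> (\<forall>i\<in>{1..k}. \<bar>c u i - c v i\<bar> \<le> 1)"
  shows "cube_rep k G (\<lambda>v. \<Pi>\<^sub>E i\<in>{1..k}. {c v i..c v i + 1})"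
  unfolding cube_rep_def intersection_rep_def is_cube_def unit_cubes_meet_iff
  using assms by blast

lemma sum_powers_2_less:
  assumes "finite I" "\<And>j. j \<in> I \<Longrightarrow> j < m"
  shows "(\<Sum>j\<in>I. 2 ^ j) < (2 ^ m :: real)"
proof -
  have "(\<Sum>j\<in>I. 2 ^ j) \<le> (\<Sum>j<m. 2 ^ j :: real)"
    using assms by (intro sum_mono2) auto
  also have "\<dots> < 2 ^ m"
    by (simp add: sum_gp_strict)
  finally show ?thesis .
qed

definition binary_value :: "nat set \<Rightarrow> (nat \<Rightarrow> nat) \<Rightarrow> real" where
  "binary_value I x = (\<Sum>j\<in>I. real (x j) * 2 ^ j)"

lemma binary_value_nonneg: "0 \<le> binary_value I x"
  unfolding binary_value_def by (intro sum_nonneg) simp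

lemma binary_value_mono: "(\<And>j. j \<in> I \<Longrightarrow> x j \<le> y j) \<Longrightarrow> binary_value I x \<le> binary_value I y"
  unfolding binary_value_def by (intro sum_mono) simp

lemma binary_value_less_power:
  assumes "finite I" "\<And>j. j \<in> I \<Longrightarrow> x j \<le> 1" "\<And>j. j \<in> I \<Longrightarrow> j < m"
  shows "binary_value I x < 2 ^ m"
proof -
  have "binary_value I x \<le> (\<Sum>j\<in>I. 2 ^ j)"
    unfolding binary_value_def using assms(2) by (intro sum_mono) simp
  then show ?thesis
    using sum_powers_2_less[OF assms(1,3)] by simp
qed

text \<open>Position \<open>m\<close> gains at least \<open>2 ^ m\<close>, more than
  \<open>x\<close> can hold on all positions below \<open>m\<close> together.\<close>

lemma binary_value_strict_mono:
  assumes I: "finite I" "m \<in> I" and x: "\<And>j. j \<in> I \<Longrightarrow> x j \<le> 1"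
    and m: "x m < y m" and above: "\<And>j. \<lbrakk>j \<in> I; m < j\<rbrakk> \<Longrightarrow> x j = y j"
  shows "binary_value I x < binary_value I y"
proof -
  have split: "binary_value I z
      = binary_value {j\<in>I. j < m} z + real (z m) * 2 ^ m + binary_value {j\<in>I. m < j} z" for z
  proof -
    have I_eq: "I = {j\<in>I. j < m} \<union> insert m {j\<in>I. m < j}"
      using I(2) by auto
    have "binary_value I z = binary_value {j\<in>I. j < m} z + binary_value (insert m {j\<in>I. m < j}) z"
      unfolding binary_value_def using I(1)
      by (subst I_eq, intro sum.union_disjoint) auto
    then show ?thesis
      using I(1) by (simp add: binary_value_def)
  qed
  have "binary_value {j\<in>I. j < m} x < 2 ^ m"
    using I x by (intro binary_value_less_power) auto
  moreover have "(real (x m) + 1) * 2 ^ m \<le> real (y m) * 2 ^ m"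
    using m by (intro mult_right_mono) auto
  moreover have "binary_value {j\<in>I. m < j} x = binary_value {j\<in>I. m < j} y"
    unfolding binary_value_def using above by (intro sum.cong) auto
  moreover have "0 \<le> binary_value {j\<in>I. j < m} y"
    by (rule binary_value_nonneg)
  ultimately show ?thesis
    unfolding split[of x] split[of y] by (simp add: algebra_simps)
qed

text \<open>Left endpoints of the unit intervals, meant for \<open>i\<close> in
  \<open>{1..d - 1}\<close>. The positions reach up to \<open>d\<close>, so dividing by
  \<open>2 ^ (d + 1)\<close> brings the binary value of a 0-1 vector below 1.\<close>

definition corner :: "nat \<Rightarrow> (nat \<Rightarrow> nat) \<Rightarrow> nat \<Rightarrow> real" where
  "corner d x i = (if i = d - 1 then real (x d) - real (x (d - 1))
     else binary_value ({1..d} - {i}) x / 2 ^ (d + 1) - real (x i))"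

text \<open>From \<open>x\<close> to \<open>y\<close>, each coordinate receives two changes of
  opposite sign, each of size at most 1, so they cannot add up to more than 1.\<close>

lemma corner_le_of_le:
  assumes x: "\<And>j. j \<in> {1..d} \<Longrightarrow> x j \<le> 1" and y: "\<And>j. j \<in> {1..d} \<Longrightarrow> y j \<le> 1"
    and le: "\<And>j. j \<in> {1..d} \<Longrightarrow> x j \<le> y j" and i: "i \<in> {1..d - 1}"
  shows "\<bar>corner d x i - corner d y i\<bar> \<le> 1"
proof (cases "i = d - 1")
  case True
  then have "x d \<le> y d" "y d \<le> 1" "x (d - 1) \<le> y (d - 1)" "y (d - 1) \<le> 1"
    using i y le by auto
  then show ?thesis
    using True by (auto simp: corner_def)
next
  case False
  define b where "b z = binary_value ({1..d} - {i}) z / 2 ^ (d + 1)" for z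
  have "0 \<le> b x"
    by (simp add: b_def binary_value_nonneg)
  moreover have "b x \<le> b y"
    unfolding b_def using le by (intro divide_right_mono binary_value_mono) auto
  moreover have "b y < 1"
    using binary_value_less_power[of "{1..d} - {i}" y "d + 1"] y by (simp add: b_def)
  moreover have "x i \<le> y i" "y i \<le> 1"
    using i le y by auto
  ultimately have "\<bar>(b x - real (x i)) - (b y - real (y i))\<bar> \<le> 1"
    by simp
  then show ?thesis
    unfolding corner_def if_not_P[OF False] b_def .
qed

lemma corner_separates:
  assumes x: "\<And>j. j \<in> {1..d} \<Longrightarrow> x j \<le> 1" and y: "\<And>j. j \<in> {1..d} \<Longrightarrow> y j \<le> 1"
    and m: "m \<in> {1..d}" "x m < y m" "\<And>j. \<lbrakk>j \<in> {1..d}; m < j\<rbrakk> \<Longrightarrow> x j = y j"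
    and i: "i \<in> {1..d}" "y i < x i"
  shows "i \<in> {1..d - 1} \<and> 1 < \<bar>corner d x i - corner d y i\<bar>"
proof -
  have "i < m"
    using m(2) m(3)[of i] i by (cases i m rule: linorder_cases) auto
  then have i_le: "i \<in> {1..d - 1}"
    using i(1) m(1) by auto
  have xi: "x i = 1" "y i = 0"
    using i x[of i] by auto
  have "1 < \<bar>corner d x i - corner d y i\<bar>"
  proof (cases "i = d - 1")
    case True
    \<comment> \<open>Only \<open>d\<close> lies above \<open>d - 1\<close>. The vectors differ in
      opposite directions at these two positions, which puts the corners 2 apart.\<close>
    then have "m = d" using \<open>i < m\<close> m(1) by auto
    then show ?thesis
      using True xi m(2) by (auto simp: corner_def)
  next
    case False
    \<comment> \<open>Dropping \<open>i\<close> keeps \<open>m\<close>, as \<open>i < m\<close>, so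
      the perturbation is strictly larger for \<open>y\<close>; this adds to the distance 1
      contributed by position \<open>i\<close>.\<close>
    have "binary_value ({1..d} - {i}) x < binary_value ({1..d} - {i}) y"
      using x m \<open>i < m\<close> by (intro binary_value_strict_mono[of _ m]) auto
    then have "binary_value ({1..d} - {i}) x / 2 ^ (d + 1) < binary_value ({1..d} - {i}) y / 2 ^ (d + 1)"
      by (intro divide_strict_right_mono) auto
    then show ?thesis
      unfolding corner_def if_not_P[OF False] xi by simp
  qed
  with i_le show ?thesis ..
qed

lemma corner_separates_incomparable:
  assumes x: "\<And>j. j \<in> {1..d} \<Longrightarrow> x j \<le> 1" and y: "\<And>j. j \<in> {1..d} \<Longrightarrow> y j \<le> 1"
    and "\<not> (\<forall>i\<in>{1..d}. x i \<le> y i)" "\<not> (\<forall>i\<in>{1..d}. x i \<ge> y i)"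
  shows "\<exists>i\<in>{1..d - 1}. 1 < \<bar>corner d x i - corner d y i\<bar>"
proof -
  obtain p q where p: "p \<in> {1..d}" "y p < x p" and q: "q \<in> {1..d}" "x q < y q"
    using assms(3,4) by (auto simp: not_le)
  define D where "D = {j\<in>{1..d}. x j \<noteq> y j}"
  define m where "m = Max D"
  have D: "finite D" "D \<noteq> {}"
    using p by (auto simp: D_def)
  then have m: "m \<in> {1..d}" "x m \<noteq> y m"
    using Max_in[OF D] by (auto simp: m_def D_def)
  have above: "x j = y j" if "j \<in> {1..d}" "m < j" for j
  proof (rule ccontr)
    assume "x j \<noteq> y j"
    then have "j \<le> m"
      using Max_ge[OF D(1), of j] that(1) by (simp add: m_def D_def)
    then show False using that(2) by simp
  qed
  show ?thesis
  \<comment> \<open>The vector that is smaller at \<open>m\<close> takes the first role; the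
    separating coordinate is a position where it exceeds the other one, \<open>p\<close> or
    \<open>q\<close>.\<close>
  proof (cases "x m < y m")
    case True
    with corner_separates[OF x y m(1) True above p] show ?thesis by blast
  next
    case False
    then have "y m < x m" using m(2) by simp
    from corner_separates[OF y x m(1) this above[symmetric] q]
    have "q \<in> {1..d - 1}" "1 < \<bar>corner d x q - corner d y q\<bar>"
      by (simp_all only: abs_minus_commute)
    then show ?thesis by blast
  qed
qed

lemma corner_close_iff_comparable:
  assumes x: "\<And>j. j \<in> {1..d} \<Longrightarrow> x j \<le> 1" and y: "\<And>j. j \<in> {1..d} \<Longrightarrow> y j \<le> 1"
  shows "(\<forall>i\<in>{1..d - 1}. \<bar>corner d x i - corner d y i\<bar> \<le> 1)
    \<longleftrightarrow> (\<forall>i\<in>{1..d}. x i \<le> y i) \<or> (\<forall>i\<in>{1..d}. x i \<ge> y i)"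
proof
  assume "\<forall>i\<in>{1..d - 1}. \<bar>corner d x i - corner d y i\<bar> \<le> 1"
  then have "\<not> (\<exists>i\<in>{1..d - 1}. 1 < \<bar>corner d x i - corner d y i\<bar>)"
    by (simp add: not_less)
  then show "(\<forall>i\<in>{1..d}. x i \<le> y i) \<or> (\<forall>i\<in>{1..d}. x i \<ge> y i)"
    using corner_separates_incomparable[of d x y] x y by blast
next
  assume "(\<forall>i\<in>{1..d}. x i \<le> y i) \<or> (\<forall>i\<in>{1..d}. x i \<ge> y i)"
  then show "\<forall>i\<in>{1..d - 1}. \<bar>corner d x i - corner d y i\<bar> \<le> 1"
  proof
    assume le: "\<forall>i\<in>{1..d}. x i \<le> y i"
    then show ?thesis
      using corner_le_of_le[of d x y, OF x y] by simp
  next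
    assume ge: "\<forall>i\<in>{1..d}. x i \<ge> y i"
    then have "\<forall>i\<in>{1..d - 1}. \<bar>corner d y i - corner d x i\<bar> \<le> 1"
      using corner_le_of_le[of d y x, OF y x] by simp
    then show ?thesis
      by (simp add: abs_minus_commute)
  qed
qed

lemma cube_rep_TC_hypercube:
  "cube_rep (d - 1) (TC_hypercube d) (\<lambda>x. \<Pi>\<^sub>E i\<in>{1..d - 1}. {corner d x i..corner d x i + 1})"
proof (rule cube_rep_of_corners)
  fix x y
  assume xy: "x \<in> pverts (TC_hypercube d)" "y \<in> pverts (TC_hypercube d)" "x \<noteq> y"
  have le_1: "z j \<le> 1" if "z \<in> pverts (TC_hypercube d)" "j \<in> {1..d}" for z j
    using PiE_mem[of z "{1..d}" "\<lambda>_. {0, 1}" j] that by (auto simp: TC_hypercube_def)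
  from corner_close_iff_comparable[OF le_1[OF xy(1)] le_1[OF xy(2)]]
  show "(x, y) \<in> parcs (TC_hypercube d)
    \<longleftrightarrow> (\<forall>i\<in>{1..d - 1}. \<bar>corner d x i - corner d y i\<bar> \<le> 1)"
    using xy by (simp add: TC_hypercube_def)
qed

text \<open>Some cube representation exists, so the least dimension is attained, and a cube
  representation is also a box representation.\<close>

lemma boxicity_le_cubicity:
  assumes "pair_graph G"
  shows "boxicity G \<le> cubicity G"
proof -
  have "\<exists>f. cube_rep (cubicity G) G f"
    unfolding cubicity_def using ex_cube_rep[OF assms] by (rule LeastI_ex)
  then show ?thesis
    unfolding boxicity_def by (blast intro: Least_le cube_rep_imp_box_rep)
qed

theorem corollary1:
  fixes d :: nat
  assumes "d \<ge> 1"
  shows "boxicity (TC_hypercube d) \<le> cubicity (TC_hypercube d)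
    \<and> cubicity (TC_hypercube d) \<le> d - 1"
proof
  show "boxicity (TC_hypercube d) \<le> cubicity (TC_hypercube d)"
    by (rule boxicity_le_cubicity[OF pair_graph_TC_hypercube])
  show "cubicity (TC_hypercube d) \<le> d - 1"
    unfolding cubicity_def using cube_rep_TC_hypercube by (blast intro: Least_le)
qed

end
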